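(* Let $G$ be a finite simple graph on $n \geq 1$ vertices with average degree $d$, minimum degree $\delta$ and maximum degree $\Delta$, and let $k \geq 0$ be an integer. Then \begin{enumerate} \item $sp(G,k) \geq \max\left\{\dfrac{n(k+1)}{2d - 2\delta + k+1},\ \dfrac{n(k+1)}{2\Delta - 2d + k+1}\right\}$; \item $sp(G,k) \leq (k+1)\, sp(G,0)$. \end{enumerate}
   Context: For a graph $G=(V,E)$ and a subset $B \subseteq V$, the spread of $B$ is $sp(B) = \max_{u \in B} \deg(u) - \min_{v \in B} \deg(v)$, where degrees are taken in $G$. For an integer $k \geq 0$, $sp(G,k)$ is the maximum cardinality of a subset $B \subseteq V$ with $sp(B) \leq k$. The average degree is $d = 2|E|/n$. *)

theory Defs
  imports Complex_Main
begin

definition simple_graph :: "'a set \<Rightarrow> 'a set set \<Rightarrow> bool" where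
  "simple_graph V E \<longleftrightarrow> finite V \<and> (\<forall>e\<in>E. e \<subseteq> V \<and> card e = 2)"

definition degree :: "'a set set \<Rightarrow> 'a \<Rightarrow> nat" where
  "degree E v = card {e \<in> E. v \<in> e}"

definition min_degree :: "'a set \<Rightarrow> 'a set set \<Rightarrow> nat" where
  "min_degree V E = Min (degree E ` V)"

definition max_degree :: "'a set \<Rightarrow> 'a set set \<Rightarrow> nat" where
  "max_degree V E = Max (degree E ` V)"

definition avg_degree :: "'a set \<Rightarrow> 'a set set \<Rightarrow> real" where
  "avg_degree V E = 2 * real (card E) / real (card V)"

text \<open>The spread is meaningful for nonempty finite \<open>B\<close> only; there the maximum is at least
  the minimum, so the subtraction on naturals does not truncate.\<close>

definition spread :: "'a set set \<Rightarrow> 'a set \<Rightarrow> nat" where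
  "spread E B = Max (degree E ` B) - Min (degree E ` B)"

text \<open>The empty set is excluded because its spread is undefined. A nonempty graph always has
  admissible sets, namely the singletons.\<close>

definition spread_number :: "'a set \<Rightarrow> 'a set set \<Rightarrow> nat \<Rightarrow> nat" where
  "spread_number V E k = Max (card ` {B. B \<subseteq> V \<and> B \<noteq> {} \<and> spread E B \<le> k})"

end

theory Submission
  imports Defs
begin

text \<open>Both lower bounds come from one counting argument, applied to the functions
  \<open>deg - \<delta>\<close> and \<open>\<Delta> - deg\<close>. Cut the values of such a function into consecutive windows of length
  \<open>k + 1\<close>, and let \<open>q v\<close> be the index of the window of \<open>v\<close>. Every window holds at most \<open>s = sp(G,k)\<close>
  vertices. Counting ordered pairs of vertices,
  \<open>n\<^sup>2 = \<Sum>v. (2 \<bar>{w. q w < q v}\<bar> + \<bar>{w. q w = q v}\<bar>) \<le> \<Sum>v. s (2 q v + 1)\<close>,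
  and \<open>(k + 1) q v\<close> is at most the value at \<open>v\<close>. For the upper bound, a set of spread at most \<open>k\<close>
  meets at most \<open>k + 1\<close> degree classes.\<close>

lemma card_filter_eq_sum:
  assumes "finite A"
  shows "card {x \<in> A. P x} = (\<Sum>x\<in>A. of_bool (P x))"
  using sum.inter_filter[OF assms, of "\<lambda>_. 1::nat" P] by (simp add: of_bool_def)

text \<open>Ordered pairs \<open>(v, w)\<close> are classified by comparing \<open>q w\<close> with
  \<open>q v\<close>. Exchanging the two entries maps the pairs with \<open>q v < q w\<close> onto
  those with \<open>q w < q v\<close>, whence the factor 2.\<close>

lemma square_card_eq_sum_card_less:
  fixes q :: "'a \<Rightarrow> 'b::linorder"
  assumes "finite V"
  shows "(card V)\<^sup>2 = (\<Sum>v\<in>V. 2 * card {w \<in> V. q w < q v} + card {w \<in> V. q w = q v})"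
proof -
  have split: "card V = card {w \<in> V. q w < q v} + card {w \<in> V. q w = q v} + card {w \<in> V. q v < q w}"
    for v
  proof -
    have "card V = (\<Sum>w\<in>V. of_bool (q w < q v) + of_bool (q w = q v) + of_bool (q v < q w))"
      unfolding card_eq_sum by (rule sum.cong) auto
    then show ?thesis
      by (simp only: card_filter_eq_sum[OF assms] sum.distrib)
  qed
  have swap: "(\<Sum>v\<in>V. card {w \<in> V. q v < q w}) = (\<Sum>v\<in>V. card {w \<in> V. q w < q v})"
    unfolding card_filter_eq_sum[OF assms] by (rule sum.swap)
  have "(card V)\<^sup>2 = (\<Sum>v\<in>V. card V)"
    by (simp add: power2_eq_square)
  also have "\<dots> = (\<Sum>v\<in>V. card {w \<in> V. q w < q v} + card {w \<in> V. q w = q v}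
      + card {w \<in> V. q v < q w})"
    by (rule sum.cong[OF refl]) (rule split)
  also have "\<dots> = (\<Sum>v\<in>V. 2 * card {w \<in> V. q w < q v} + card {w \<in> V. q w = q v})"
    by (simp add: sum.distrib swap flip: sum_distrib_left)
  finally show ?thesis .
qed

lemma square_card_le_if_windows_small:
  fixes f :: "'a \<Rightarrow> nat"
  assumes "finite V" and "m > 0"
    and window: "\<And>c. card {v \<in> V. c \<le> f v \<and> f v < c + m} \<le> s"
  shows "m * (card V)\<^sup>2 \<le> s * (2 * sum f V + m * card V)"
proof -
  define q where "q v = f v div m" for v
  have eq: "card {v \<in> V. q v = t} \<le> s" for t
  proof -
    have "{v \<in> V. q v = t} \<subseteq> {v \<in> V. t * m \<le> f v \<and> f v < t * m + m}"
      using \<open>m > 0\<close> by (auto simp: q_def dividend_less_div_times add.commute)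
    then have "card {v \<in> V. q v = t} \<le> card {v \<in> V. t * m \<le> f v \<and> f v < t * m + m}"
      using \<open>finite V\<close> by (intro card_mono) auto
    then show ?thesis
      using window le_trans by blast
  qed
  \<comment> \<open>The vertices below window \<open>t\<close> fill the \<open>t\<close> windows
    \<open>0, ..., t - 1\<close>, each of size at most \<open>s\<close>.\<close>
  have less: "card {v \<in> V. q v < t} \<le> s * t" for t
  proof (induction t)
    case (Suc t)
    have "{v \<in> V. q v < Suc t} = {v \<in> V. q v < t} \<union> {v \<in> V. q v = t}"
      by auto
    then have "card {v \<in> V. q v < Suc t} \<le> card {v \<in> V. q v < t} + card {v \<in> V. q v = t}"
      by (simp add: card_Un_le)
    with Suc eq[of t] show ?case
      by simp
  qed simp
  have "m * (card V)\<^sup>2 \<le> m * (\<Sum>v\<in>V. 2 * (s * q v) + s)"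
    unfolding square_card_eq_sum_card_less[OF \<open>finite V\<close>, of q]
    by (intro mult_le_mono2 sum_mono add_mono less eq)
  also have "\<dots> = (\<Sum>v\<in>V. s * (2 * (q v * m) + m))"
    by (simp add: sum_distrib_left algebra_simps)
  \<comment> \<open>Here \<open>q v * m\<close> is the left end of the window containing
    \<open>f v\<close>.\<close>
  also have "\<dots> \<le> (\<Sum>v\<in>V. s * (2 * f v + m))"
    by (intro sum_mono mult_le_mono2 add_mono) (auto simp: q_def)
  also have "\<dots> = s * (2 * sum f V + m * card V)"
    by (simp add: sum.distrib flip: sum_distrib_left)
  finally show ?thesis .
qed

text \<open>The number \<open>a\<close> is the mean of \<open>f\<close>, so one factor
  \<open>card V\<close> cancels from the quadratic estimate. As a mean of naturals it is
  nonnegative, which keeps the denominator positive.\<close>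

lemma real_bound_if_windows_small:
  fixes f :: "'a \<Rightarrow> nat" and a :: real
  assumes "finite V" and "V \<noteq> {}"
    and window: "\<And>c. card {v \<in> V. c \<le> f v \<and> f v < c + (k + 1)} \<le> s"
    and a: "real (card V) * a = real (sum f V)"
  shows "real (card V) * (real k + 1) / (2 * a + real k + 1) \<le> real s"
proof -
  have n: "real (card V) > 0"
    using assms(1,2) by (simp add: card_gt_0_iff)
  have "real (card V) * a \<ge> 0"
    unfolding a by (rule of_nat_0_le_iff)
  with n have "a \<ge> 0"
    by (simp add: zero_le_mult_iff)
  have "real ((k + 1) * (card V)\<^sup>2) \<le> real (s * (2 * sum f V + (k + 1) * card V))"
    using square_card_le_if_windows_small[OF \<open>finite V\<close> _ window] by (intro of_nat_mono) simp
  then have "(real k + 1) * (real (card V))\<^sup>2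
      \<le> real s * (2 * (real (card V) * a) + (real k + 1) * real (card V))"
    unfolding a by (simp add: algebra_simps)
  then have "real (card V) * (real (card V) * (real k + 1))
      \<le> real (card V) * (real s * (2 * a + real k + 1))"
    by (simp add: algebra_simps power2_eq_square)
  then have "real (card V) * (real k + 1) \<le> real s * (2 * a + real k + 1)"
    using n by simp
  then show ?thesis
    using \<open>a \<ge> 0\<close> by (subst pos_divide_le_eq) auto
qed

text \<open>Handshake lemma, by double counting incident pairs of a vertex and an edge.\<close>

lemma sum_degree_eq_twice_card_edges:
  assumes "simple_graph V E"
  shows "(\<Sum>v\<in>V. degree E v) = 2 * card E"
proof -
  have V: "finite V" and E: "\<And>e. e \<in> E \<Longrightarrow> e \<subseteq> V \<and> card e = 2"
    using assms by (auto simp: simple_graph_def)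
  have "finite E"
    using V E by (intro finite_subset[of E "Pow V"]) auto
  have "(\<Sum>v\<in>V. degree E v) = (\<Sum>e\<in>E. card {v \<in> V. v \<in> e})"
    unfolding degree_def card_filter_eq_sum[OF V] card_filter_eq_sum[OF \<open>finite E\<close>]
    by (rule sum.swap)
  also have "\<dots> = (\<Sum>e\<in>E. 2)"
  proof (rule sum.cong[OF refl])
    fix e assume "e \<in> E"
    with E have "{v \<in> V. v \<in> e} = e" "card e = 2"
      by auto
    then show "card {v \<in> V. v \<in> e} = 2"
      by simp
  qed
  finally show ?thesis
    by simp
qed

text \<open>The pairwise condition avoids \<open>Max\<close> and \<open>Min\<close> and also makes
  sense for empty \<open>B\<close>, so windows and degree classes that contain no vertex need no
  separate treatment later.\<close>

lemma card_le_spread_number: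
  assumes "finite V" and "V \<noteq> {}" and "B \<subseteq> V"
    and close: "\<And>u v. u \<in> B \<Longrightarrow> v \<in> B \<Longrightarrow> degree E u \<le> degree E v + k"
  shows "card B \<le> spread_number V E k"
proof (cases "B = {}")
  case False
  have "finite B"
    using assms finite_subset by blast
  with False have "Max (degree E ` B) \<in> degree E ` B" "Min (degree E ` B) \<in> degree E ` B"
    by auto
  then have "spread E B \<le> k"
    unfolding spread_def using close by fastforce
  with False assms show ?thesis
    unfolding spread_number_def by (intro Max_ge) auto
qed simp

lemma spread_number_attained:
  assumes "finite V" and "V \<noteq> {}"
  obtains B where "B \<subseteq> V" "B \<noteq> {}" "spread E B \<le> k" "card B = spread_number V E k"
proof -
  let ?S = "{B. B \<subseteq> V \<and> B \<noteq> {} \<and> spread E B \<le> k}"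
  obtain v where "v \<in> V"
    using assms by auto
  then have "{v} \<in> ?S"
    by (simp add: spread_def)
  moreover have "finite ?S"
    using assms by simp
  ultimately have "spread_number V E k \<in> card ` ?S"
    unfolding spread_number_def by (intro Max_in) auto
  then obtain B where "B \<in> ?S" "spread_number V E k = card B"
    by (rule imageE)
  with that[of B] show ?thesis
    by simp
qed

lemma spread_number_le_mult_spread_number_0:
  assumes "finite V" and "V \<noteq> {}"
  shows "spread_number V E k \<le> (k + 1) * spread_number V E 0"
proof -
  obtain B where B: "B \<subseteq> V" "B \<noteq> {}" "spread E B \<le> k" "card B = spread_number V E k"
    using assms by (rule spread_number_attained)
  define a where "a = Min (degree E ` B)"
  have "finite B"
    using B assms finite_subset by blast
  have "degree E v \<in> {a..a + k}" if "v \<in> B" for v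
  proof -
    have "a \<le> degree E v" "degree E v \<le> Max (degree E ` B)"
      using that \<open>finite B\<close> by (auto simp: a_def)
    with B(3) show ?thesis
      by (auto simp: spread_def a_def)
  qed
  then have "B = (\<Union>i\<in>{a..a + k}. {v \<in> B. degree E v = i})"
    by auto
  then have "card B \<le> (\<Sum>i\<in>{a..a + k}. card {v \<in> B. degree E v = i})"
    using card_UN_le[of "{a..a + k}" "\<lambda>i. {v \<in> B. degree E v = i}"] by simp
  \<comment> \<open>All degrees within one class coincide, so each class satisfies the pairwise
    condition with bound 0; there are \<open>k + 1\<close> classes.\<close>
  also have "\<dots> \<le> (\<Sum>i\<in>{a..a + k}. spread_number V E 0)"
    using assms B by (intro sum_mono card_le_spread_number) auto
  finally show ?thesis
    using B by simp
qed

theorem theorem2p1: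
  fixes V :: "'a set" and E :: "'a set set" and n k \<delta> \<Delta> :: nat and d :: real
  assumes "simple_graph V E"
    and "n = card V" and "n \<ge> 1"
    and "d = avg_degree V E"
    and "\<delta> = min_degree V E"
    and "\<Delta> = max_degree V E"
  shows "real (spread_number V E k) \<ge>
           max (real n * (real k + 1) / (2 * d - 2 * real \<delta> + real k + 1))
               (real n * (real k + 1) / (2 * real \<Delta> - 2 * d + real k + 1))
         \<and> spread_number V E k \<le> (k + 1) * spread_number V E 0"
proof -
  have V: "finite V" "V \<noteq> {}"
    using assms by (auto simp: simple_graph_def)
  \<comment> \<open>These bounds make the natural subtractions below exact, so the shifted values
    have means \<open>d - real \<delta>\<close> and \<open>real \<Delta> - d\<close>.\<close>
  have \<delta>: "\<delta> \<le> degree E v" and \<Delta>: "degree E v \<le> \<Delta>" if "v \<in> V" for v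
    using that V assms by (auto simp: min_degree_def max_degree_def)
  have nd: "real n * d = (\<Sum>v\<in>V. real (degree E v))"
    using assms(2-4) sum_degree_eq_twice_card_edges[OF assms(1)]
    by (simp add: avg_degree_def flip: of_nat_sum)
  have "real (card V) * (real k + 1) / (2 * (d - real \<delta>) + real k + 1)
      \<le> real (spread_number V E k)"
  proof (rule real_bound_if_windows_small[OF V])
    show "card {v \<in> V. c \<le> degree E v - \<delta> \<and> degree E v - \<delta> < c + (k + 1)}
        \<le> spread_number V E k" for c
      \<comment> \<open>Two integers in a window of length \<open>k + 1\<close> differ by at most
        \<open>k\<close>, and the shift by \<delta> preserves differences of degrees.\<close>
      using V \<delta> by (intro card_le_spread_number) fastforce+
    have "real (\<Sum>v\<in>V. degree E v - \<delta>) = (\<Sum>v\<in>V. real (degree E v) - real \<delta>)"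
      using \<delta> by (simp add: of_nat_diff)
    then show "real (card V) * (d - real \<delta>) = real (\<Sum>v\<in>V. degree E v - \<delta>)"
      using nd assms(2) by (simp add: sum_subtractf algebra_simps)
  qed
  moreover have "real (card V) * (real k + 1) / (2 * (real \<Delta> - d) + real k + 1)
      \<le> real (spread_number V E k)"
  proof (rule real_bound_if_windows_small[OF V])
    show "card {v \<in> V. c \<le> \<Delta> - degree E v \<and> \<Delta> - degree E v < c + (k + 1)}
        \<le> spread_number V E k" for c
      \<comment> \<open>The reflection at \<Delta> reverses the order of degrees but keeps their
        distances.\<close>
      using V \<Delta> by (intro card_le_spread_number) fastforce+
    have "real (\<Sum>v\<in>V. \<Delta> - degree E v) = (\<Sum>v\<in>V. real \<Delta> - real (degree E v))"
      using \<Delta> by (simp add: of_nat_diff)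
    then show "real (card V) * (real \<Delta> - d) = real (\<Sum>v\<in>V. \<Delta> - degree E v)"
      using nd assms(2) by (simp add: sum_subtractf algebra_simps)
  qed
  ultimately show ?thesis
    using spread_number_le_mult_spread_number_0[OF V] assms(2) by (simp add: algebra_simps)
qed

end
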